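(* Let $k\ge 1$ and $F^k\subsetneq N\setminus\{1\}$, and let $(x^{k-1},\epsilon^{k-1})$ be a feasible solution to $(M^k)$ satisfying $$\mathcal{H}_k:\quad x^{k-1}(N\setminus\{i\})=v(N\setminus\{i\})+\epsilon^{k-1}\quad\text{for each } i\in N\setminus F^k,\ i\ne 1.$$ Let $$\mu=\min_{S\notin\mathcal{F}^k,\ 1\notin S}\frac{x^{k-1}(S)-v(S)-\epsilon^{k-1}}{1+|S\setminus F^k|}$$ and let $\bar S$ be a minimizer. Then the solution $(x^k,\epsilon^k)$ defined by $$x^k_i=\begin{cases}x^{k-1}_i+\mu\,(n-1-|F^k|)&\text{if } i=1,\\ x^{k-1}_i-\mu&\text{if } i\notin F^k,\ i\neq 1,\\ x^{k-1}_i&\text{otherwise,}\end{cases}\qquad \epsilon^k=\epsilon^{k-1}+\mu,$$ is an optimal solution to $(M^k)$. Moreover, the components of the nucleolus $\nu$ of $(N,v)$ satisfy $\nu_i=v(N)-v(N\setminus\{i\})-\epsilon^k$ for all $i\in\bar S\setminus F^k$, and, defining $F^{k+1}=\bar S\cup F^k$, $(x^k,\epsilon^k)$ is a feasible solution to $(M^{k+1})$ satisfying $$\mathcal{H}_{k+1}:\quad x^{k}(N\setminus\{i\})=v(N\setminus\{i\})+\epsilon^{k}\quad\text{for each } i\in N\setminus F^{k+1},\ i\ne 1.$$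
   Context: Single market uncapacitated production-distribution game: players $N=\{1,\dots,n\}$, per-unit profits numbered so that $\alpha_1\ge\alpha_2\ge\dots\ge\alpha_n\ge 0$, and demands $d_i\ge 0$; the value of a nonempty $S\subseteq N$ is $v(S)=\big(\sum_{i\in S}d_i\big)\cdot\max_{k\in S}\alpha_k$, i.e. $\alpha_i\,d(S)$ with $i=\min S$, and $v(\emptyset)=0$. For $x\in\mathbb{R}^n$, $x(S)=\sum_{i\in S}x_i$. Nucleolus: for $x\in\mathbb{R}^n$ with $x(N)=v(N)$, let $e_S(x)=x(S)-v(S)$ for $S\subseteq N$ and let $\overrightarrow{e(x)}\in\mathbb{R}^{2^n}$ be the vector of all excesses in non-decreasing order. The nucleolus $\nu$ is the unique $x$ with $x(N)=v(N)$ for which $\overrightarrow{e(x)}$ is lexicographically maximal. For a set $F^k\subseteq N\setminus\{1\}$, identify subsets of $N$ with characteristic vectors and let $$\mathcal{F}^k=\{S\subseteq N: S\in\mathrm{span}(\{\{i\}:i\in F^k\}\cup\{N\})\},\qquad \varphi^k=\{\{i\}:i\in F^k\}\cup\{N\setminus\{i\}:i\in F^k\}\cup\{N\}.$$ The linear program $(M^k)$, in variables $(x,\epsilon)\in\mathbb{R}^n\times\mathbb{R}$, is $$\max\ \epsilon\quad\text{s.t.}\quad x(S)\ge v(S)+\epsilon\ \ \forall S\in 2^N\setminus\mathcal{F}^k;\qquad x(S)=c^k(S)\ \ \forall S\in\varphi^k,$$ where $c^k(S)=\nu(S)$ for all $S\in\varphi^k$ (in particular $c^k(N)=v(N)$):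 $F^k$ is the set of components for which the value of the nucleolus has already been fixed. The program $(M^{k+1})$ is defined in the same way from $F^{k+1}$, with $c^{k+1}(S)=\nu(S)$ for $S\in\varphi^{k+1}$. *)

theory Defs
  imports
    Complex_Main
    "HOL-Library.Function_Algebras"
    "HOL-Library.Indicator_Function"
    "HOL-Library.Multiset"
begin

text \<open>
  The player set is \<open>{1..n}\<close>. A vector in \<open>\<real>^n\<close> is a function \<open>nat \<Rightarrow> real\<close> of which only the
  values on \<open>{1..n}\<close> are used, and \<open>x(S)\<close> is \<open>sum x S\<close>.
\<close>

interpretation real_fun: vector_space "\<lambda>(c::real) (f::nat \<Rightarrow> real) i. c * f i"
  by unfold_locales (auto simp: plus_fun_def fun_eq_iff algebra_simps)

definition pd_game :: "(nat \<Rightarrow> real) \<Rightarrow> (nat \<Rightarrow> real) \<Rightarrow> nat set \<Rightarrow> real" where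
  "pd_game \<alpha> d S = (if S = {} then 0 else (\<Sum>i\<in>S. d i) * Max (\<alpha> ` S))"

definition sorted_excesses :: "nat \<Rightarrow> (nat set \<Rightarrow> real) \<Rightarrow> (nat \<Rightarrow> real) \<Rightarrow> real list" where
  "sorted_excesses n v x =
     sorted_list_of_multiset (image_mset (\<lambda>S. sum x S - v S) (mset_set (Pow {1..n})))"

text \<open>
  Only lexicographic maximality is required here; that the maximizer exists and is unique
  (as a vector, i.e. on \<open>{1..n}\<close>) is a theorem, not part of the definition. All lists compared have
  length \<open>2^n\<close>.
\<close>

definition is_nucleolus :: "nat \<Rightarrow> (nat set \<Rightarrow> real) \<Rightarrow> (nat \<Rightarrow> real) \<Rightarrow> bool" where
  "is_nucleolus n v x \<longleftrightarrow>
     sum x {1..n} = v {1..n} \<and>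
     (\<forall>y. sum y {1..n} = v {1..n} \<longrightarrow>
        lexordp_eq (sorted_excesses n v y) (sorted_excesses n v x))"

definition fixed_coalitions :: "nat \<Rightarrow> nat set \<Rightarrow> nat set set" where
  "fixed_coalitions n F =
     {S. S \<subseteq> {1..n} \<and>
         indicat_real S \<in> real_fun.span ((\<lambda>T. indicat_real T) ` ({{i} | i. i \<in> F} \<union> {{1..n}}))}"

definition equality_coalitions :: "nat \<Rightarrow> nat set \<Rightarrow> nat set set" where
  "equality_coalitions n F = {{i} | i. i \<in> F} \<union> {{1..n} - {i} | i. i \<in> F} \<union> {{1..n}}"

definition feasible_M ::
  "nat \<Rightarrow> (nat set \<Rightarrow> real) \<Rightarrow> (nat \<Rightarrow> real) \<Rightarrow> nat set \<Rightarrow> (nat \<Rightarrow> real) \<Rightarrow> real \<Rightarrow> bool" where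
  "feasible_M n v \<nu> F x \<epsilon> \<longleftrightarrow>
     (\<forall>S \<in> Pow {1..n} - fixed_coalitions n F. sum x S \<ge> v S + \<epsilon>) \<and>
     (\<forall>S \<in> equality_coalitions n F. sum x S = sum \<nu> S)"

definition optimal_M ::
  "nat \<Rightarrow> (nat set \<Rightarrow> real) \<Rightarrow> (nat \<Rightarrow> real) \<Rightarrow> nat set \<Rightarrow> (nat \<Rightarrow> real) \<Rightarrow> real \<Rightarrow> bool" where
  "optimal_M n v \<nu> F x \<epsilon> \<longleftrightarrow>
     feasible_M n v \<nu> F x \<epsilon> \<and> (\<forall>x' \<epsilon>'. feasible_M n v \<nu> F x' \<epsilon>' \<longrightarrow> \<epsilon>' \<le> \<epsilon>)"

definition H_cond ::
  "nat \<Rightarrow> (nat set \<Rightarrow> real) \<Rightarrow> nat set \<Rightarrow> (nat \<Rightarrow> real) \<Rightarrow> real \<Rightarrow> bool" where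
  "H_cond n v F x \<epsilon> \<longleftrightarrow>
     (\<forall>i \<in> {1..n} - F. i \<noteq> 1 \<longrightarrow> sum x ({1..n} - {i}) = v ({1..n} - {i}) + \<epsilon>)"

definition candidates :: "nat \<Rightarrow> nat set \<Rightarrow> nat set set" where
  "candidates n F = {S. S \<subseteq> {1..n} \<and> S \<notin> fixed_coalitions n F \<and> 1 \<notin> S}"

definition ratio ::
  "(nat set \<Rightarrow> real) \<Rightarrow> nat set \<Rightarrow> (nat \<Rightarrow> real) \<Rightarrow> real \<Rightarrow> nat set \<Rightarrow> real" where
  "ratio v F x \<epsilon> S = (sum x S - v S - \<epsilon>) / (1 + real (card (S - F)))"

definition step_x :: "nat \<Rightarrow> nat set \<Rightarrow> real \<Rightarrow> (nat \<Rightarrow> real) \<Rightarrow> nat \<Rightarrow> real" where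
  "step_x n F \<mu> x i =
     (if i = 1 then x i + \<mu> * (real n - 1 - real (card F))
      else if i \<notin> F then x i - \<mu>
      else x i)"

end

theory Submission
  imports Defs
begin

text \<open>
  The step keeps \<open>x(N)\<close> and the coordinates in \<open>F\<close>, and lowers the excess of a coalition \<open>S\<close> without
  player 1 by \<open>\<mu> |S - F|\<close>, so \<open>\<mu>\<close> is the largest step for which the new solution is feasible.
  For every feasible \<open>y\<close> the sum of \<open>y(Sbar)\<close> and of \<open>y(N - {i})\<close> over \<open>i \<in> Sbar - F\<close> has the same
  value, and each of these \<open>1 + |Sbar - F|\<close> constraints is tight at \<open>(x', \<epsilon>')\<close>; hence \<open>\<epsilon>'\<close> is optimal
  and they are tight at every optimal solution. Finally \<open>(\<nu>, \<epsilon>')\<close> is itself feasible: \<open>\<nu>\<close> and \<open>x'\<close> have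
  equal excesses on the fixed coalitions, so an excess of \<open>\<nu>\<close> below \<open>\<epsilon>'\<close> on another coalition would
  make \<open>x'\<close> lexicographically better than \<open>\<nu>\<close>.
\<close>

section \<open>Lexicographic comparison of sorted multisets\<close>

lemma sorted_lexordp_eq_count_le:
  fixes xs ys :: "'a::linorder list"
  assumes "length xs = length ys" "lexordp_eq xs ys" "sorted xs" "sorted ys"
    and "\<forall>t<b. count (mset xs) t = count (mset ys) t"
  shows "count (mset ys) b \<le> count (mset xs) b"
  using assms
proof (induction xs ys rule: list_induct2)
  case Nil
  then show ?case by simp
next
  case (Cons x xs y ys)
  show ?case
  proof (cases "x = y")
    case True
    have "\<forall>t<b. count (mset xs) t = count (mset ys) t"
      using Cons.prems(4) True by (auto split: if_splits)
    then show ?thesis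
      using Cons True by simp
  next
    case False
    with Cons.prems(1) have "x < y" by auto
    \<comment> \<open>Every entry of \<open>y # ys\<close> exceeds \<open>x\<close>, so its counts
      vanish up to \<open>x\<close>. Equal counts below \<open>b\<close> then force
      \<open>b \<le> x\<close>, because \<open>x\<close> occurs in the first list only.\<close>
    then have absent: "count (mset (y # ys)) t = 0" if "t \<le> x" for t
      using Cons.prems(3) that by (auto simp: count_eq_zero_iff)
    have "b \<le> x"
    proof (rule ccontr)
      assume "\<not> b \<le> x"
      then have "count (mset (x # xs)) x = count (mset (y # ys)) x"
        using Cons.prems(4) by (meson not_le)
      then show False using absent[of x] by simp
    qed
    then show ?thesis using absent by simp
  qed
qed

text \<open>If the smallest entry \<open>m\<close> of \<open>B\<close> were below \<open>e\<close>,
  then \<open>C\<close> would have nothing up to \<open>m\<close>. The two sums would have equal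
  counts below \<open>m\<close>, but \<open>K + B\<close> more copies of \<open>m\<close>, hence be
  lexicographically smaller. This lets the common part \<open>K\<close> be ignored.\<close>

lemma lexordp_eq_sorted_mset_add_imp:
  fixes K B C :: "'a::linorder multiset"
  assumes lex: "lexordp_eq (sorted_list_of_multiset (K + C)) (sorted_list_of_multiset (K + B))"
    and "size C = size B" and "\<forall>c\<in>#C. e \<le> c" and "b \<in># B"
  shows "e \<le> b"
proof (rule ccontr)
  assume "\<not> e \<le> b"
  define m where "m = Min (set_mset B)"
  have "m \<in># B" "\<forall>t\<in>#B. m \<le> t"
    using \<open>b \<in># B\<close> by (auto simp: m_def intro: Min_in)
  then have "m < e" using \<open>b \<in># B\<close> \<open>\<not> e \<le> b\<close> by force
  have C0: "count C t = 0" if "t \<le> m" for t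
    using assms(3) that \<open>m < e\<close> by (force simp: count_eq_zero_iff)
  have B0: "count B t = 0" if "t < m" for t
    using \<open>\<forall>t\<in>#B. m \<le> t\<close> that by (force simp: count_eq_zero_iff)
  let ?xs = "sorted_list_of_multiset (K + C)"
  let ?ys = "sorted_list_of_multiset (K + B)"
  have "length ?xs = length ?ys"
    using \<open>size C = size B\<close> by (metis mset_sorted_list_of_multiset size_mset size_union)
  then have "count (mset ?ys) m \<le> count (mset ?xs) m"
    using lex by (rule sorted_lexordp_eq_count_le) (auto simp: C0 B0)
  then have "count B m = 0" using C0[of m] by simp
  with \<open>m \<in># B\<close> show False by (simp add: count_eq_zero_iff)
qed

section \<open>The linear span behind the fixed coalitions\<close>

lemma sum_mult_indicat_real:
  assumes "S \<subseteq> A" "finite A"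
  shows "(\<Sum>j\<in>A. y j * indicat_real S j) = sum y S"
proof -
  have "(\<Sum>j\<in>A. y j * indicat_real S j) = (\<Sum>j\<in>A. if j \<in> S then y j else 0)"
    by (rule sum.cong) auto
  also have "\<dots> = sum y (A \<inter> S)"
    using assms(2) by (simp add: sum.inter_restrict)
  also have "A \<inter> S = S" using assms(1) by auto
  finally show ?thesis .
qed

lemma fixed_coalitions_mono:
  assumes "F \<subseteq> F'"
  shows "fixed_coalitions n F \<subseteq> fixed_coalitions n F'"
proof -
  have "(\<lambda>T. indicat_real T) ` ({{i} | i. i \<in> F} \<union> {{1..n}})
      \<subseteq> (\<lambda>T. indicat_real T) ` ({{i} | i. i \<in> F'} \<union> {{1..n}})"
    using assms by (intro image_mono) auto
  from real_fun.span_mono[OF this] show ?thesis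
    unfolding fixed_coalitions_def by blast
qed

lemma subset_fixed_coalitions:
  assumes "S \<subseteq> F" "F \<subseteq> {1..n}"
  shows "S \<in> fixed_coalitions n F"
proof -
  let ?G = "(\<lambda>T. indicat_real T) ` ({{i} | i. i \<in> F} \<union> {{1..n}})"
  have SN: "S \<subseteq> {1..n}" using assms by blast
  have "finite S" by (rule finite_subset[OF SN]) simp
  then have "indicat_real S \<in> real_fun.span ?G"
    using \<open>S \<subseteq> F\<close>
  proof (induction S rule: finite_induct)
    case empty
    have "indicat_real {} = (0 :: nat \<Rightarrow> real)" by (simp add: fun_eq_iff)
    then show ?case by (simp only: real_fun.span_zero)
  next
    case (insert a S)
    have "indicat_real {a} \<in> real_fun.span ?G"
      using insert.prems by (intro real_fun.span_base) auto
    moreover have "indicat_real (insert a S) = indicat_real {a} + indicat_real S"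
      using insert.hyps by (auto simp: fun_eq_iff plus_fun_def indicator_def)
    moreover have "indicat_real S \<in> real_fun.span ?G"
      using insert.IH insert.prems by blast
    ultimately show ?case
      by (simp only: real_fun.span_add)
  qed
  with SN show ?thesis by (simp add: fixed_coalitions_def)
qed

lemma Compl_fixed_coalitions:
  assumes "S \<in> fixed_coalitions n F"
  shows "{1..n} - S \<in> fixed_coalitions n F"
proof -
  let ?G = "(\<lambda>T. indicat_real T) ` ({{i} | i. i \<in> F} \<union> {{1..n}})"
  have "indicat_real {1..n} \<in> real_fun.span ?G"
    by (intro real_fun.span_base) auto
  moreover have "indicat_real ({1..n} - S) = indicat_real {1..n} - indicat_real S"
    using assms by (auto simp: fixed_coalitions_def fun_eq_iff fun_diff_def indicator_def)
  moreover have "indicat_real S \<in> real_fun.span ?G"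
    using assms by (simp add: fixed_coalitions_def)
  ultimately have "indicat_real ({1..n} - S) \<in> real_fun.span ?G"
    by (simp only: real_fun.span_diff)
  then show ?thesis by (simp add: fixed_coalitions_def)
qed

text \<open>With \<open>i\<close> and \<open>j\<close> both outside \<open>F\<close>, every
  generator takes equal values at \<open>i\<close> and \<open>j\<close>. This persists on the span,
  but the indicator of \<open>{1..n} - {i}\<close> separates them.\<close>

lemma Diff_singleton_notin_fixed_coalitions:
  assumes "i \<in> {1..n}" "j \<in> {1..n}" "i \<noteq> j" "i \<notin> F" "j \<notin> F"
  shows "{1..n} - {i} \<notin> fixed_coalitions n F"
proof
  assume "{1..n} - {i} \<in> fixed_coalitions n F"
  then have "indicat_real ({1..n} - {i}) \<in>
      real_fun.span ((\<lambda>T. indicat_real T) ` ({{i} | i. i \<in> F} \<union> {{1..n}}))"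
    by (simp add: fixed_coalitions_def)
  moreover have "real_fun.span ((\<lambda>T. indicat_real T) ` ({{i} | i. i \<in> F} \<union> {{1..n}})) \<subseteq> {f. f i = f j}"
  proof (rule real_fun.span_minimal)
    show "real_fun.subspace {f. f i = f j}"
      by (rule real_fun.subspaceI) auto
  qed (use assms in \<open>auto simp: indicator_def\<close>)
  ultimately have "indicat_real ({1..n} - {i}) \<in> {f. f i = f j}" by blast
  then show False using assms by (auto simp: indicator_def)
qed

text \<open>A vector acts on indicators as a linear functional. The functions on which
  \<open>y\<close> and \<open>z\<close> act alike form a subspace containing the generators, hence
  the span.\<close>

lemma sum_fixed_coalitions_cong:
  fixes y z :: "nat \<Rightarrow> real"
  assumes "S \<in> fixed_coalitions n F" "F \<subseteq> {1..n}"
    and "\<forall>i\<in>F. y i = z i" "sum y {1..n} = sum z {1..n}"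
  shows "sum y S = sum z S"
proof -
  let ?V = "{f. (\<Sum>j\<in>{1..n}. y j * f j) = (\<Sum>j\<in>{1..n}. z j * f j)}"
  have sub: "real_fun.subspace ?V"
    by (rule real_fun.subspaceI)
      (auto simp: algebra_simps sum.distrib simp flip: sum_distrib_left)
  have eq: "indicat_real T \<in> ?V \<longleftrightarrow> sum y T = sum z T" if "T \<subseteq> {1..n}" for T
    using that by (simp only: mem_Collect_eq sum_mult_indicat_real[OF _ finite_atLeastAtMost])
  have "real_fun.span ((\<lambda>T. indicat_real T) ` ({{i} | i. i \<in> F} \<union> {{1..n}})) \<subseteq> ?V"
  proof (rule real_fun.span_minimal[OF subsetI sub])
    fix f :: "nat \<Rightarrow> real"
    assume "f \<in> (\<lambda>T. indicat_real T) ` ({{i} | i. i \<in> F} \<union> {{1..n}})"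
    then obtain T where f: "f = indicat_real T" and T: "T = {1..n} \<or> (\<exists>i\<in>F. T = {i})" by auto
    then have "T \<subseteq> {1..n}" "sum y T = sum z T" using assms(2-4) by auto
    then show "f \<in> ?V" using f eq by blast
  qed
  moreover have "S \<subseteq> {1..n}" "indicat_real S \<in>
      real_fun.span ((\<lambda>T. indicat_real T) ` ({{i} | i. i \<in> F} \<union> {{1..n}}))"
    using assms(1) by (simp_all add: fixed_coalitions_def)
  ultimately show ?thesis using eq by blast
qed

section \<open>The linear program and the nucleolus\<close>

lemma feasible_M_iff:
  assumes "F \<subseteq> {1..n}"
  shows "feasible_M n v \<nu> F y \<eta> \<longleftrightarrow>
    (\<forall>S. S \<subseteq> {1..n} \<longrightarrow> S \<notin> fixed_coalitions n F \<longrightarrow> v S + \<eta> \<le> sum y S) \<and>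
    (\<forall>i\<in>F. y i = \<nu> i) \<and> sum y {1..n} = sum \<nu> {1..n}"
proof -
  have "sum y ({1..n} - {i}) = sum \<nu> ({1..n} - {i})"
    if "i \<in> F" "y i = \<nu> i" "sum y {1..n} = sum \<nu> {1..n}" for i
    using that assms by (auto simp: sum_diff1)
  moreover have "(\<forall>S\<in>equality_coalitions n F. P S) \<longleftrightarrow>
      (\<forall>i\<in>F. P {i} \<and> P ({1..n} - {i})) \<and> P {1..n}" for P
    unfolding equality_coalitions_def by blast
  ultimately have "(\<forall>S\<in>equality_coalitions n F. sum y S = sum \<nu> S) \<longleftrightarrow>
      (\<forall>i\<in>F. y i = \<nu> i) \<and> sum y {1..n} = sum \<nu> {1..n}"
    by auto
  then show ?thesis
    unfolding feasible_M_def by auto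
qed

text \<open>The fixed coalitions contribute the same multiset \<open>K\<close> to the excesses of
  \<open>y\<close> and \<open>\<nu>\<close>. Only the parts \<open>M y\<close> and
  \<open>M \<nu>\<close> can differ, and \<open>lexordp_eq_sorted_mset_add_imp\<close> carries the
  lower bound from one to the other.\<close>

lemma is_nucleolus_feasible_M:
  assumes nuc: "is_nucleolus n v \<nu>" and F: "F \<subseteq> {1..n}" and feas: "feasible_M n v \<nu> F y \<eta>"
  shows "feasible_M n v \<nu> F \<nu> \<eta>"
proof -
  let ?Fix = "fixed_coalitions n F"
  note y = feas[unfolded feasible_M_iff[OF F]]
  define K where "K = image_mset (\<lambda>S. sum \<nu> S - v S) (mset_set ?Fix)"
  define M where "M z = image_mset (\<lambda>S. sum z S - v S) (mset_set (Pow {1..n} - ?Fix))"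
    for z :: "nat \<Rightarrow> real"
  have Pow: "?Fix \<subseteq> Pow {1..n}" by (auto simp: fixed_coalitions_def)
  then have fin: "finite ?Fix" using finite_subset by blast
  have split: "mset_set (Pow {1..n}) = mset_set ?Fix + mset_set (Pow {1..n} - ?Fix)"
    using mset_set_Union[of ?Fix "Pow {1..n} - ?Fix"] Pow fin by (simp add: Un_absorb1)
  have "sorted_excesses n v z = sorted_list_of_multiset (K + M z)"
    if "\<forall>S\<in>?Fix. sum z S = sum \<nu> S" for z
  proof -
    have "image_mset (\<lambda>S. sum z S - v S) (mset_set ?Fix) = K"
      unfolding K_def using that fin by (intro image_mset_cong) auto
    then show ?thesis
      unfolding sorted_excesses_def M_def split by simp
  qed
  moreover have "\<forall>S\<in>?Fix. sum y S = sum \<nu> S"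
    using sum_fixed_coalitions_cong[OF _ F] y by blast
  moreover have "lexordp_eq (sorted_excesses n v y) (sorted_excesses n v \<nu>)"
    using nuc y by (auto simp: is_nucleolus_def)
  ultimately have lex: "lexordp_eq (sorted_list_of_multiset (K + M y))
      (sorted_list_of_multiset (K + M \<nu>))" by simp
  have "\<eta> \<le> sum \<nu> S - v S" if "S \<subseteq> {1..n}" "S \<notin> ?Fix" for S
  proof (rule lexordp_eq_sorted_mset_add_imp[OF lex])
    show "size (M y) = size (M \<nu>)" by (simp add: M_def)
    have "\<eta> \<le> sum y T - v T" if "T \<in> Pow {1..n} - ?Fix" for T
      using y that by (auto simp: algebra_simps)
    then show "\<forall>c\<in>#M y. \<eta> \<le> c" by (auto simp: M_def)
    show "sum \<nu> S - v S \<in># M \<nu>" using that by (auto simp: M_def)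
  qed
  then show ?thesis
    unfolding feasible_M_iff[OF F] le_diff_eq by (simp add: add.commute)
qed

section \<open>Coalition sums of the step vector\<close>

lemma sum_step_x:
  assumes "finite S" "1 \<notin> S"
  shows "sum (step_x n F \<mu> x) S = sum x S - \<mu> * card (S - F)"
proof -
  have "sum (step_x n F \<mu> x) S = (\<Sum>i\<in>S. x i - (if i \<in> S - F then \<mu> else 0))"
    using assms(2) by (intro sum.cong) (auto simp: step_x_def)
  also have "\<dots> = sum x S - (\<Sum>i\<in>S. if i \<in> S - F then \<mu> else 0)"
    by (simp add: sum_subtractf)
  also have "(\<Sum>i\<in>S. if i \<in> S - F then \<mu> else 0) = sum (\<lambda>_. \<mu>) (S \<inter> (S - F))"
    using assms(1) by (simp only: sum.inter_restrict)
  also have "S \<inter> (S - F) = S - F" by auto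
  finally show ?thesis by (simp add: mult.commute)
qed

text \<open>Player 1 receives exactly what the other \<open>n - 1 - card F\<close> players outside
  \<open>F\<close> give up.\<close>

lemma sum_step_x_univ:
  assumes "1 \<le> n" "F \<subseteq> {1..n} - {1}"
  shows "sum (step_x n F \<mu> x) {1..n} = sum x {1..n}"
proof -
  have "finite F" using assms(2) finite_subset by blast
  have "card ({1..n} - {1} - F) + card F = n - 1"
    using assms \<open>finite F\<close> card_mono[OF _ assms(2)] by (simp add: card_Diff_subset)
  then have "real (card ({1..n} - {1} - F)) + real (card F) = real n - 1"
    using assms(1) by (metis of_nat_1 of_nat_add of_nat_diff)
  moreover have "sum z {1..n} = z 1 + sum z ({1..n} - {1})" for z :: "nat \<Rightarrow> real"
    using assms(1) by (intro sum.remove) auto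
  moreover have "step_x n F \<mu> x 1 = x 1 + \<mu> * (real n - 1 - real (card F))"
    by (simp add: step_x_def)
  moreover have "sum (step_x n F \<mu> x) ({1..n} - {1})
      = sum x ({1..n} - {1}) - \<mu> * card ({1..n} - {1} - F)"
    by (intro sum_step_x) auto
  ultimately show ?thesis
    by (smt (verit, best) mult.commute right_diff_distrib)
qed

section \<open>Optimality and passage to the next program\<close>

theorem lemma7:
  fixes n :: nat and \<alpha> d \<nu> x x' :: "nat \<Rightarrow> real" and v :: "nat set \<Rightarrow> real"
    and F F' Sbar :: "nat set" and \<epsilon> \<epsilon>' \<mu> :: real
  assumes "\<forall>i\<in>{1..n}. \<forall>j\<in>{1..n}. i \<le> j \<longrightarrow> \<alpha> j \<le> \<alpha> i"
    and "\<forall>i\<in>{1..n}. 0 \<le> \<alpha> i"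
    and "\<forall>i\<in>{1..n}. 0 \<le> d i"
    and "v = pd_game \<alpha> d"
    and "is_nucleolus n v \<nu>"
    and "F \<subset> {1..n} - {1}"
    and "feasible_M n v \<nu> F x \<epsilon>"
    and "H_cond n v F x \<epsilon>"
    and "\<mu> = Min (ratio v F x \<epsilon> ` candidates n F)"
    and "Sbar \<in> candidates n F" and "ratio v F x \<epsilon> Sbar = \<mu>"
    and "x' = step_x n F \<mu> x" and "\<epsilon>' = \<epsilon> + \<mu>"
    and "F' = Sbar \<union> F"
  shows "optimal_M n v \<nu> F x' \<epsilon>' \<and>
    (\<forall>i \<in> Sbar - F. \<nu> i = v {1..n} - v ({1..n} - {i}) - \<epsilon>') \<and>
    feasible_M n v \<nu> F' x' \<epsilon>' \<and>
    H_cond n v F' x' \<epsilon>'"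
proof -
  note F = assms(6) and x' = assms(12) and \<epsilon>' = assms(13)
  let ?N = "{1..n}"
  let ?Fix = "fixed_coalitions n F"
  have FN: "F \<subseteq> ?N" using F by auto
  have n: "1 \<le> n" using F by fastforce
  note x = assms(7)[unfolded feasible_M_iff[OF FN]]
  have vN: "sum \<nu> ?N = v ?N" using assms(5) by (simp add: is_nucleolus_def)
  have fin: "finite (candidates n F)"
    by (rule finite_subset[of _ "Pow ?N"]) (auto simp: candidates_def)
  \<comment> \<open>Subsets of \<open>F\<close> are fixed coalitions, so a candidate has a player
    outside \<open>F\<close>.\<close>
  have card_pos: "1 \<le> card (S - F)" if "S \<in> candidates n F" for S
  proof -
    have "S - F \<noteq> {}" "S \<subseteq> ?N"
      using that subset_fixed_coalitions[OF _ FN] by (auto simp: candidates_def)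
    moreover from this have "finite S" using finite_subset by blast
    ultimately show ?thesis by (simp add: Suc_le_eq card_gt_0_iff)
  qed
  have S: "Sbar \<subseteq> ?N" "Sbar \<notin> ?Fix" "1 \<notin> Sbar"
    using assms(10) by (auto simp: candidates_def)
  have finS: "finite Sbar" using S(1) finite_subset by blast
  \<comment> \<open>Feasibility of \<open>x\<close> makes the numerator of the ratio nonnegative at
    \<open>Sbar\<close>.\<close>
  have "0 \<le> \<mu>"
    using x S by (auto simp: ratio_def simp flip: assms(11) intro!: divide_nonneg_pos)
  have slack: "\<mu> * (1 + real (card (S - F))) \<le> sum x S - v S - \<epsilon>" if "S \<in> candidates n F" for S
  proof -
    have "\<mu> \<le> ratio v F x \<epsilon> S"
      unfolding assms(9) using fin that by (intro Min_le) auto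
    then show ?thesis by (simp add: ratio_def pos_le_divide_eq)
  qed
  have sum_x': "sum x' T = sum x T - \<mu> * card (T - F)" if "T \<subseteq> ?N" "1 \<notin> T" for T
    using that finite_subset[OF that(1)] unfolding x' by (intro sum_step_x) auto
  have x'N: "sum x' ?N = sum x ?N"
    using sum_step_x_univ[OF n] F by (auto simp: x')
  have co: "sum z (?N - T) = sum z ?N - sum z T" if "T \<subseteq> ?N" for z :: "nat \<Rightarrow> real" and T
    using that by (simp add: sum_diff)
  have ineq: "v S + \<epsilon>' \<le> sum x' S" if T: "S \<subseteq> ?N" "S \<notin> ?Fix" for S
  proof (cases "1 \<in> S")
    case False
    then have "S \<in> candidates n F" using T by (simp add: candidates_def)
    \<comment> \<open>The coalition loses \<open>\<mu>\<close> per player outside \<open>F\<close>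
      while the bound rises by \<open>\<mu>\<close>, which explains the \<open>1 +\<close> in the
      denominator of \<open>ratio\<close>.\<close>
    then show ?thesis
      using slack[of S] sum_x'[OF T(1) False] by (simp add: \<epsilon>' algebra_simps)
  next
    case True
    \<comment> \<open>The complement of \<open>S\<close> is a candidate, so it loses at least
      \<open>\<mu>\<close>. As the total is unchanged, \<open>S\<close> gains at least
      \<open>\<mu>\<close>.\<close>
    have dd: "?N - (?N - S) = S" using T(1) by auto
    then have "?N - S \<notin> ?Fix" using Compl_fixed_coalitions T(2) by metis
    then have "1 \<le> card (?N - S - F)" using True by (intro card_pos) (auto simp: candidates_def)
    then have "\<mu> * 1 \<le> \<mu> * real (card (?N - S - F))"
      using \<open>0 \<le> \<mu>\<close> by (intro mult_left_mono) auto
    moreover have "sum x' (?N - S) = sum x (?N - S) - \<mu> * card (?N - S - F)"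
      using True by (intro sum_x') auto
    moreover have "v S + \<epsilon> \<le> sum x S" using x T by blast
    ultimately show ?thesis
      using x'N co[OF T(1), of x] co[OF T(1), of x'] by (simp add: \<epsilon>')
  qed
  have "\<forall>i\<in>F. x' i = \<nu> i" using x F by (auto simp: x' step_x_def)
  then have feas: "feasible_M n v \<nu> F x' \<epsilon>'"
    using ineq x'N x unfolding feasible_M_iff[OF FN] by simp
  have N1: "?N - {i} \<notin> ?Fix" if "i \<in> Sbar - F" for i
    using that S n F by (intro Diff_singleton_notin_fixed_coalitions[where j = 1]) auto
  have tight: "sum x' (?N - {i}) = v (?N - {i}) + \<epsilon>'" if "i \<in> ?N - F" "i \<noteq> 1" for i
  proof -
    have "sum x (?N - {i}) = v (?N - {i}) + \<epsilon>" using assms(8) that by (simp add: H_cond_def)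
    moreover have "x' i = x i - \<mu>" using that by (simp add: x' step_x_def)
    ultimately show ?thesis
      using that x'N co[of "{i}" x] co[of "{i}" x'] by (simp add: \<epsilon>')
  qed
  have tightS: "sum x' Sbar = v Sbar + \<epsilon>'"
  proof -
    have "\<mu> * (1 + real (card (Sbar - F))) = sum x Sbar - v Sbar - \<epsilon>"
      using assms(11) by (simp add: ratio_def divide_eq_eq)
    then show ?thesis using sum_x'[OF S(1) S(3)] by (simp add: \<epsilon>' algebra_simps)
  qed
  define slk where "slk y i = sum y (?N - {i}) - v (?N - {i})" for y :: "nat \<Rightarrow> real" and i
  \<comment> \<open>Up to constants and the fixed total, \<open>slk y i\<close> is
    \<open>- y i\<close>, which cancels against the same term of \<open>sum y Sbar\<close>, while
    the players in \<open>F\<close> have prescribed values. The sum can therefore be evaluated at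
    \<open>x'\<close>, where each term is \<open>\<epsilon>'\<close>.\<close>
  have total: "(\<Sum>i\<in>Sbar - F. slk y i) + (sum y Sbar - v Sbar) = (1 + real (card (Sbar - F))) * \<epsilon>'"
    if "feasible_M n v \<nu> F y \<eta>" for y \<eta>
  proof -
    have yi: "slk y i = slk x' i + (x' i - y i)" if "i \<in> Sbar - F" for i
    proof -
      have "i \<in> ?N" using that S by auto
      then show ?thesis
        using x'N x \<open>feasible_M n v \<nu> F y \<eta>\<close> co[of "{i}" y] co[of "{i}" x']
        by (simp add: slk_def feasible_M_iff[OF FN])
    qed
    have "sum y Sbar = sum y (Sbar - F) + sum y (Sbar \<inter> F)" for y :: "nat \<Rightarrow> real"
      using finS by (metis add.commute sum.Int_Diff)
    moreover have "sum y (Sbar \<inter> F) = sum x' (Sbar \<inter> F)"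
      using that feas by (intro sum.cong) (auto simp: feasible_M_iff[OF FN])
    ultimately have "sum y Sbar = sum x' Sbar - (\<Sum>i\<in>Sbar - F. x' i - y i)"
      by (simp add: sum_subtractf)
    moreover have "(\<Sum>i\<in>Sbar - F. slk y i) = (\<Sum>i\<in>Sbar - F. slk x' i) + (\<Sum>i\<in>Sbar - F. x' i - y i)"
      using yi by (simp flip: sum.distrib)
    moreover have "(\<Sum>i\<in>Sbar - F. slk x' i) = (\<Sum>i\<in>Sbar - F. \<epsilon>')"
    proof (intro sum.cong refl)
      fix i assume "i \<in> Sbar - F"
      then have "i \<in> ?N - F" "i \<noteq> 1" using S by auto
      then show "slk x' i = \<epsilon>'" using tight by (simp add: slk_def)
    qed
    ultimately show ?thesis using tightS by (simp add: algebra_simps)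
  qed
  have slk_ge: "\<eta> \<le> slk y i" if "feasible_M n v \<nu> F y \<eta>" "i \<in> Sbar - F" for y \<eta> i
    using that N1[OF that(2)] by (auto simp: slk_def feasible_M_iff[OF FN] algebra_simps)
  have opt: "optimal_M n v \<nu> F x' \<epsilon>'"
    unfolding optimal_M_def
  proof (intro conjI allI impI feas)
    fix y \<eta> assume y: "feasible_M n v \<nu> F y \<eta>"
    have "(\<Sum>i\<in>Sbar - F. \<eta>) \<le> (\<Sum>i\<in>Sbar - F. slk y i)"
      using slk_ge[OF y] by (rule sum_mono)
    moreover have "v Sbar + \<eta> \<le> sum y Sbar"
      using y S by (simp add: feasible_M_iff[OF FN])
    ultimately have "(1 + real (card (Sbar - F))) * \<eta> \<le> (1 + real (card (Sbar - F))) * \<epsilon>'"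
      using total[OF y] by (simp add: algebra_simps)
    then show "\<eta> \<le> \<epsilon>'"
      by (simp add: mult_le_cancel_left_pos add_pos_nonneg)
  qed
  have \<nu>: "feasible_M n v \<nu> F \<nu> \<epsilon>'"
    using is_nucleolus_feasible_M[OF assms(5) FN feas] .
  have \<nu>_val: "\<nu> i = v ?N - v (?N - {i}) - \<epsilon>'" if i: "i \<in> Sbar - F" for i
  proof -
    \<comment> \<open>The differences \<open>slk \<nu> i - \<epsilon>'\<close> are nonnegative, and
      this bound with \<open>total\<close> makes their sum at most 0, so each vanishes.\<close>
    have "v Sbar + \<epsilon>' \<le> sum \<nu> Sbar"
      using \<nu> S by (simp add: feasible_M_iff[OF FN])
    then have "(\<Sum>i\<in>Sbar - F. slk \<nu> i - \<epsilon>') \<le> 0"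
      using total[OF \<nu>] by (simp add: sum_subtractf algebra_simps)
    moreover have "slk \<nu> i - \<epsilon>' \<le> (\<Sum>i\<in>Sbar - F. slk \<nu> i - \<epsilon>')"
      using slk_ge[OF \<nu>] i finS by (intro member_le_sum) auto
    ultimately have "slk \<nu> i = \<epsilon>'" using slk_ge[OF \<nu> i] by simp
    moreover have "i \<in> ?N" using i S by auto
    ultimately show ?thesis
      using co[of "{i}" \<nu>] vN by (simp add: slk_def)
  qed
  have F'N: "F' \<subseteq> ?N" using FN S assms(14) by auto
  have "x' i = \<nu> i" if "i \<in> F'" for i
  proof (cases "i \<in> F")
    case True
    then show ?thesis using \<open>\<forall>i\<in>F. x' i = \<nu> i\<close> by blast
  next
    case False
    \<comment> \<open>For a newly fixed player, \<open>x'\<close> and \<open>\<nu>\<close> have the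
      same total and the same tight value on \<open>?N - {i}\<close>.\<close>
    then have i: "i \<in> Sbar - F" "i \<in> ?N" "i \<noteq> 1" using that assms(14) S by auto
    then show ?thesis
      using \<nu>_val[of i] tight[of i] co[of "{i}" x'] x'N x vN by simp
  qed
  \<comment> \<open>Enlarging \<open>F\<close> enlarges the family of fixed coalitions, so the
    inequalities still required are among those in \<open>ineq\<close>.\<close>
  then have "feasible_M n v \<nu> F' x' \<epsilon>'"
    using ineq x'N x fixed_coalitions_mono[of F F' n] assms(14)
    unfolding feasible_M_iff[OF F'N] by auto
  moreover have "H_cond n v F' x' \<epsilon>'"
    using tight assms(14) by (auto simp: H_cond_def)
  ultimately show ?thesis using opt \<nu>_val by blast
qed

end
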